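(* Let $n\ge 1$ and $k_1,\dots,k_n\ge 1$ be integers, let $N=k_1+\cdots+k_n$, and let $c_{ij}\in\mathbb N$ ($i=1,\dots,n$, $j=1,\dots,k_i$) be costs that are ordered in descending order for each $i$: $c_{iq}\ge c_{ip}$ whenever $1\le q<p\le k_i$. Write $\mathbf c=(c_{11},\dots,c_{1k_1},\dots,c_{n1},\dots,c_{nk_n})$ as a row vector. Let $D$ be the $n\times N$ matrix whose columns are indexed by the pairs $(i,j)$ in the order $(1,1),\dots,(1,k_1),(2,1),\dots,(n,k_n)$ and whose $i$-th row has entry $1$ in the columns $(i,1),\dots,(i,k_i)$ and $0$ elsewhere. Let $A$ be the $(n+N+1)\times(2N+n+1)$ integer matrix $$A=\begin{pmatrix} D & -I_n & 0_{n\times N} & 0_{n\times 1}\\ I_N & 0_{N\times n} & I_N & 0_{N\times 1}\\ \mathbf c & 0_{1\times n} & 0_{1\times N} & 1\end{pmatrix},$$ whose columns correspond, in order, to the variables $\bm z=(x_{11},\dots,x_{nk_n},\,d_1,\dots,d_n,\,t_{11},\dots,t_{nk_n},\,b)$. Let $k=\mathbb R$, let $I_A\subset k[\bm z]$ be the toric ideal of $A$, and let $$\mathcal G=\{\,x_{ik}d_i-t_{ik}b^{c_{ik}} : 1\le i\le n,\ 1\le k\le k_i\,\}\cup\{\,x_{iq}t_{ip}-x_{ip}t_{iq}b^{c_{iq}-c_{ip}} : 1\le i\le n,\ 1\le q<p\le k_i\,\}.$$ Let $>$ be the lexicographic term order on $k[\bm z]$ with $$x_{11}>\cdots>x_{1k_1}>x_{21}>\cdots>x_{nk_n}>d_1>\cdots>d_n>t_{11}>\cdots>t_{1k_1}>t_{21}>\cdots>t_{nk_n}>b.$$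 Then $\mathcal G$ is the reduced Gröbner basis of $I_A$ with respect to $>$. Moreover, $\mathcal G$ is the reduced Gröbner basis of $I_A$ with respect to the term order $<_{\bm c}$ induced by the cost vector $\mathbf c$.
   Context: $\mathbb N$ denotes the nonnegative integers. Put $s=2N+n+1$. **Toric ideal.** $I_A=\langle \bm z^{\alpha}-\bm z^{\beta} : \alpha,\beta\in\mathbb N^{s},\ A\alpha=A\beta\rangle\subset k[\bm z]$. **Term order induced by the cost vector.** For an exponent vector $\alpha\in\mathbb N^{s}$, let $\alpha_x\in\mathbb N^N$ denote the part of $\alpha$ corresponding to the $x$-variables. The cost (weight) of $\bm z^\alpha$ is $\mathbf c\cdot\alpha_x$; that is, the variables $d_i,t_{ij},b$ have weight $0$ and $x_{ij}$ has weight $c_{ij}$. Then $\alpha>_{\bm c}\beta$ means that either $\mathbf c\cdot\alpha_x>\mathbf c\cdot\beta_x$, or $\mathbf c\cdot\alpha_x=\mathbf c\cdot\beta_x$ and $\alpha>\beta$ in the lexicographic order $>$ of the claim. **Gröbner bases.** For a term order $\prec$ and a nonzero polynomial $f$, $\mathrm{in}_\prec(f)$ is the term of $f$ whose exponent is largest with respect to $\prec$. For an ideal $J$, $\mathrm{in}_\prec(J)=\langle \mathrm{in}_\prec(f): f\in J\rangle$. A finite subset $\mathcal G\subset J$ is a Gröbner basis of $J$ with respect to $\prec$ if $\mathrm{in}_\prec(J)=\langle \mathrm{in}_\prec(g): g\in\mathcal G\rangle$. It is the reduced Gröbner basis if, in addition, every $\mathrm{in}_\prec(g)$, $g\in\mathcal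 G$, has coefficient $1$, and for each $g\in\mathcal G$ no monomial appearing in $g$ lies in $\langle \mathrm{in}_\prec(g') : g'\in\mathcal G\setminus\{g\}\rangle$. *)

theory Defs
  imports Complex_Main "HOL-Library.Poly_Mapping" "HOL-Algebra.Ideal"
begin

section \<open>Polynomial rings and reduced Groebner bases\<close>

text \<open>Exponent vectors are finitely supported functions from variables to \<open>nat\<close>, and polynomials
  are finitely supported functions from exponent vectors to coefficients. The type of all such
  functions is a polynomial ring in all elements of \<open>'v\<close>; the ring \<open>k[V]\<close> below only uses the
  variables in \<open>V\<close>, and ideals are taken in that ring.\<close>

abbreviation keys :: "('a \<Rightarrow>\<^sub>0 'b::zero) \<Rightarrow> 'a set" where
  "keys \<equiv> Poly_Mapping.keys"

abbreviation lookup :: "('a \<Rightarrow>\<^sub>0 'b::zero) \<Rightarrow> 'a \<Rightarrow> 'b" where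
  "lookup \<equiv> Poly_Mapping.lookup"

type_synonym 'v exponent = "'v \<Rightarrow>\<^sub>0 nat"
type_synonym 'v mpoly = "'v exponent \<Rightarrow>\<^sub>0 real"

definition mpoly_ring :: "'v set \<Rightarrow> 'v mpoly ring" where
  "mpoly_ring V =
     \<lparr>carrier = {p. \<forall>m \<in> keys p. keys m \<subseteq> V}, monoid.mult = (*), one = 1, zero = 0, add = (+)\<rparr>"

lemma mpoly_ring_simps:
  "p \<in> carrier (mpoly_ring V) \<longleftrightarrow> (\<forall>m \<in> keys p. keys m \<subseteq> V)"
  "p \<otimes>\<^bsub>mpoly_ring V\<^esub> q = p * q" "\<one>\<^bsub>mpoly_ring V\<^esub> = 1"
  "p \<oplus>\<^bsub>mpoly_ring V\<^esub> q = p + q" "\<zero>\<^bsub>mpoly_ring V\<^esub> = 0"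
  by (simp_all add: mpoly_ring_def)

lemma cring_mpoly_ring: "cring (mpoly_ring V)"
proof (rule cringI)
  note ops = mpoly_ring_simps(2-5)
  have add: "p + q \<in> carrier (mpoly_ring V)"
    if "p \<in> carrier (mpoly_ring V)" "q \<in> carrier (mpoly_ring V)" for p q
    using that keys_add[of p q] unfolding mpoly_ring_simps by blast
  have mult: "p * q \<in> carrier (mpoly_ring V)"
    if p: "p \<in> carrier (mpoly_ring V)" and q: "q \<in> carrier (mpoly_ring V)" for p q
    unfolding mpoly_ring_simps
  proof
    fix m assume "m \<in> keys (p * q)"
    then obtain a b where m: "m = a + b" "a \<in> keys p" "b \<in> keys q"
      using keys_mult[of p q] by blast
    have "keys a \<subseteq> V" "keys b \<subseteq> V"
      using p q m(2,3) unfolding mpoly_ring_simps by blast+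
    then show "keys m \<subseteq> V"
      unfolding m(1) using keys_add[of a b] by blast
  qed
  have zero: "0 \<in> carrier (mpoly_ring V)" and one: "1 \<in> carrier (mpoly_ring V)"
    by (simp_all add: mpoly_ring_simps(1))
  have minus: "- p \<in> carrier (mpoly_ring V)" if "p \<in> carrier (mpoly_ring V)" for p
    using that by (simp only: mpoly_ring_simps(1) Poly_Mapping.keys.rep_eq
        uminus_poly_mapping.rep_eq fun_Compl_def neg_equal_0_iff_equal)
  show "abelian_group (mpoly_ring V)"
  proof (rule abelian_groupI, unfold ops)
    fix p assume "p \<in> carrier (mpoly_ring V)"
    then show "\<exists>q \<in> carrier (mpoly_ring V). q + p = 0"
      using minus left_minus by blast
  qed (rule add zero add.assoc add.commute add_0 | assumption)+
  show "Group.comm_monoid (mpoly_ring V)"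
    by (rule comm_monoidI, unfold ops)
      (rule mult one mult.assoc mult.commute mult_1 | assumption)+
qed (simp only: mpoly_ring_simps(2-5) distrib_right)

definition mvar :: "'v \<Rightarrow> 'v mpoly" where
  "mvar v = Poly_Mapping.single (Poly_Mapping.single v 1) 1"

definition mmonom :: "'v exponent \<Rightarrow> 'v mpoly" where
  "mmonom m = Poly_Mapping.single m 1"

text \<open>A term order is passed as its strict part: \<open>prec \<alpha> \<beta>\<close> says that \<open>\<alpha>\<close> is smaller than \<open>\<beta>\<close>.
  The description in \<open>lead_exp\<close> is only meaningful for nonzero polynomials, while \<open>lead_term\<close> of
  the zero polynomial is zero.\<close>

definition lead_exp :: "('v exponent \<Rightarrow> 'v exponent \<Rightarrow> bool) \<Rightarrow> 'v mpoly \<Rightarrow> 'v exponent" where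
  "lead_exp prec f = (THE m. m \<in> keys f \<and> (\<forall>m' \<in> keys f. m' \<noteq> m \<longrightarrow> prec m' m))"

definition lead_coef :: "('v exponent \<Rightarrow> 'v exponent \<Rightarrow> bool) \<Rightarrow> 'v mpoly \<Rightarrow> real" where
  "lead_coef prec f = lookup f (lead_exp prec f)"

definition lead_term :: "('v exponent \<Rightarrow> 'v exponent \<Rightarrow> bool) \<Rightarrow> 'v mpoly \<Rightarrow> 'v mpoly" where
  "lead_term prec f = Poly_Mapping.single (lead_exp prec f) (lead_coef prec f)"

lemma lead_term_zero [simp]: "lead_term prec 0 = 0"
  by (simp add: lead_term_def lead_coef_def)

definition initial_ideal ::
    "'v set \<Rightarrow> ('v exponent \<Rightarrow> 'v exponent \<Rightarrow> bool) \<Rightarrow> 'v mpoly set \<Rightarrow> 'v mpoly set" where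
  "initial_ideal V prec F = Idl\<^bsub>mpoly_ring V\<^esub> (lead_term prec ` F)"

definition groebner_basis ::
    "'v set \<Rightarrow> ('v exponent \<Rightarrow> 'v exponent \<Rightarrow> bool) \<Rightarrow> 'v mpoly set \<Rightarrow> 'v mpoly set \<Rightarrow> bool" where
  "groebner_basis V prec J G \<longleftrightarrow>
     finite G \<and> G \<subseteq> J \<and> initial_ideal V prec J = initial_ideal V prec G"

definition reduced_groebner_basis ::
    "'v set \<Rightarrow> ('v exponent \<Rightarrow> 'v exponent \<Rightarrow> bool) \<Rightarrow> 'v mpoly set \<Rightarrow> 'v mpoly set \<Rightarrow> bool" where
  "reduced_groebner_basis V prec J G \<longleftrightarrow>
     groebner_basis V prec J G \<and>
     (\<forall>g \<in> G. lead_coef prec g = 1) \<and>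
     (\<forall>g \<in> G. \<forall>m \<in> keys g. mmonom m \<notin> initial_ideal V prec (G - {g}))"

text \<open>The toric ideal of an integer matrix with row index set \<open>R\<close> and column index set \<open>V\<close>.\<close>

definition toric_ideal :: "'r set \<Rightarrow> 'v set \<Rightarrow> ('r \<Rightarrow> 'v \<Rightarrow> int) \<Rightarrow> 'v mpoly set" where
  "toric_ideal R V A = Idl\<^bsub>mpoly_ring V\<^esub>
     {mmonom \<alpha> - mmonom \<beta> | \<alpha> \<beta>. keys \<alpha> \<subseteq> V \<and> keys \<beta> \<subseteq> V \<and>
        (\<forall>r \<in> R. (\<Sum>v \<in> V. A r v * int (lookup \<alpha> v)) =
                (\<Sum>v \<in> V. A r v * int (lookup \<beta> v)))}"

section \<open>The matrix, its columns and the term orders\<close>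

text \<open>\<open>VX i j\<close>, \<open>VD i\<close>, \<open>VT i j\<close> and \<open>VB\<close> stand for \<open>x\<^sub>i\<^sub>j\<close>, \<open>d\<^sub>i\<close>, \<open>t\<^sub>i\<^sub>j\<close> and \<open>b\<close>; indices start
  at 1.\<close>

datatype var = VX nat nat | VD nat | VT nat nat | VB

text \<open>Variables are ordered by their position in the list
  \<open>x\<^sub>1\<^sub>1, x\<^sub>1\<^sub>2, \<dots>, d\<^sub>1, \<dots>, t\<^sub>1\<^sub>1, \<dots>, b\<close>. So \<open>v < w\<close> says that \<open>v\<close> precedes \<open>w\<close> in this list, which in
  the term order makes \<open>v\<close> the larger variable.\<close>

fun precedes :: "var \<Rightarrow> var \<Rightarrow> bool" where
  "precedes (VX i j) (VX i' j') \<longleftrightarrow> i < i' \<or> (i = i' \<and> j < j')"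
| "precedes (VX i j) w \<longleftrightarrow> True"
| "precedes (VD i) (VX i' j') \<longleftrightarrow> False"
| "precedes (VD i) (VD i') \<longleftrightarrow> i < i'"
| "precedes (VD i) w \<longleftrightarrow> True"
| "precedes (VT i j) (VT i' j') \<longleftrightarrow> i < i' \<or> (i = i' \<and> j < j')"
| "precedes (VT i j) w \<longleftrightarrow> w = VB"
| "precedes VB w \<longleftrightarrow> False"

instantiation var :: linorder
begin

definition less_var :: "var \<Rightarrow> var \<Rightarrow> bool" where
  "less_var = precedes"

definition less_eq_var :: "var \<Rightarrow> var \<Rightarrow> bool" where
  "less_eq_var v w \<longleftrightarrow> v = w \<or> precedes v w"

instance
proof
  fix u v w :: var
  show "v < w \<longleftrightarrow> v \<le> w \<and> \<not> w \<le> v"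
    by (cases v; cases w) (auto simp: less_var_def less_eq_var_def)
  show "v \<le> v"
    by (simp add: less_eq_var_def)
  show "u \<le> w" if "u \<le> v" "v \<le> w"
    using that by (cases u; cases v; cases w) (auto simp: less_eq_var_def)
  show "v = w" if "v \<le> w" "w \<le> v"
    using that by (cases v; cases w) (auto simp: less_eq_var_def)
  show "v \<le> w \<or> w \<le> v"
    by (cases v; cases w) (auto simp: less_eq_var_def)
qed

end

text \<open>With this order on variables, the library order on finitely supported functions is the
  lexicographic term order.\<close>

abbreviation lex_less :: "var exponent \<Rightarrow> var exponent \<Rightarrow> bool" where
  "lex_less \<equiv> (<)"

lemma lex_less_iff:
  "lex_less \<alpha> \<beta> \<longleftrightarrow> (\<exists>v. lookup \<alpha> v < lookup \<beta> v \<and> (\<forall>w. precedes w v \<longrightarrow> lookup \<alpha> w = lookup \<beta> w))"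
  by (simp add: less_poly_mapping.rep_eq less_fun_def less_var_def)

definition pairs :: "nat \<Rightarrow> (nat \<Rightarrow> nat) \<Rightarrow> (nat \<times> nat) set" where
  "pairs n k = (SIGMA i:{1..n}. {1..k i})"

definition vars :: "nat \<Rightarrow> (nat \<Rightarrow> nat) \<Rightarrow> var set" where
  "vars n k = (\<lambda>(i, j). VX i j) ` pairs n k \<union> VD ` {1..n} \<union> (\<lambda>(i, j). VT i j) ` pairs n k \<union> {VB}"

definition cost :: "nat \<Rightarrow> (nat \<Rightarrow> nat) \<Rightarrow> (nat \<Rightarrow> nat \<Rightarrow> nat) \<Rightarrow> var exponent \<Rightarrow> nat" where
  "cost n k c \<alpha> = (\<Sum>(i, j) \<in> pairs n k. c i j * lookup \<alpha> (VX i j))"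

definition cost_less ::
    "nat \<Rightarrow> (nat \<Rightarrow> nat) \<Rightarrow> (nat \<Rightarrow> nat \<Rightarrow> nat) \<Rightarrow> var exponent \<Rightarrow> var exponent \<Rightarrow> bool" where
  "cost_less n k c \<alpha> \<beta> \<longleftrightarrow>
     cost n k c \<alpha> < cost n k c \<beta> \<or> (cost n k c \<alpha> = cost n k c \<beta> \<and> lex_less \<alpha> \<beta>)"

text \<open>The rows of the matrix come in three blocks, of sizes \<open>n\<close>, \<open>N\<close> and 1.\<close>

datatype row = Row_D nat | Row_I nat nat | Row_c

definition rows :: "nat \<Rightarrow> (nat \<Rightarrow> nat) \<Rightarrow> row set" where
  "rows n k = Row_D ` {1..n} \<union> (\<lambda>(i, j). Row_I i j) ` pairs n k \<union> {Row_c}"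

fun matA :: "(nat \<Rightarrow> nat \<Rightarrow> nat) \<Rightarrow> row \<Rightarrow> var \<Rightarrow> int" where
  "matA c (Row_D i) (VX i' j') = (if i' = i then 1 else 0)"
| "matA c (Row_D i) (VD i') = (if i' = i then -1 else 0)"
| "matA c (Row_D i) (VT i' j') = 0"
| "matA c (Row_D i) VB = 0"
| "matA c (Row_I i j) (VX i' j') = (if i' = i \<and> j' = j then 1 else 0)"
| "matA c (Row_I i j) (VD i') = 0"
| "matA c (Row_I i j) (VT i' j') = (if i' = i \<and> j' = j then 1 else 0)"
| "matA c (Row_I i j) VB = 0"
| "matA c Row_c (VX i' j') = int (c i' j')"
| "matA c Row_c (VD i') = 0"
| "matA c Row_c (VT i' j') = 0"
| "matA c Row_c VB = 1"

lemma card_pairs: "card (pairs n k) = (\<Sum>i = 1..n. k i)"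
  by (simp add: pairs_def)

lemma finite_pairs: "finite (pairs n k)"
  by (simp add: pairs_def)

lemma card_vars: "card (vars n k) = 2 * (\<Sum>i = 1..n. k i) + n + 1"
proof -
  have "card ((\<lambda>(i, j). VX i j) ` pairs n k) = (\<Sum>i = 1..n. k i)"
    "card ((\<lambda>(i, j). VT i j) ` pairs n k) = (\<Sum>i = 1..n. k i)" "card (VD ` {1..n}) = n"
    by (subst card_image; force simp: inj_on_def card_pairs)+
  moreover have
    "((\<lambda>(i, j). VX i j) ` pairs n k \<union> VD ` {1..n} \<union> (\<lambda>(i, j). VT i j) ` pairs n k) \<inter> {VB} = {}"
    "((\<lambda>(i, j). VX i j) ` pairs n k \<union> VD ` {1..n}) \<inter> (\<lambda>(i, j). VT i j) ` pairs n k = {}"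
    "(\<lambda>(i, j). VX i j) ` pairs n k \<inter> VD ` {1..n} = {}"
    by auto
  ultimately show ?thesis
    unfolding vars_def by (simp only: card_Un_disjoint finite_pairs finite_imageI finite_UnI
        finite_atLeastAtMost finite.intros card.insert card.empty) simp
qed

lemma card_rows: "card (rows n k) = n + (\<Sum>i = 1..n. k i) + 1"
proof -
  have "card ((\<lambda>(i, j). Row_I i j) ` pairs n k) = (\<Sum>i = 1..n. k i)" "card (Row_D ` {1..n}) = n"
    by (subst card_image; force simp: inj_on_def card_pairs)+
  moreover have
    "(Row_D ` {1..n} \<union> (\<lambda>(i, j). Row_I i j) ` pairs n k) \<inter> {Row_c} = {}"
    "Row_D ` {1..n} \<inter> (\<lambda>(i, j). Row_I i j) ` pairs n k = {}"
    by auto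
  ultimately show ?thesis
    unfolding rows_def by (simp only: card_Un_disjoint finite_pairs finite_imageI finite_UnI
        finite_atLeastAtMost finite.intros card.insert card.empty) simp
qed

definition basisG :: "nat \<Rightarrow> (nat \<Rightarrow> nat) \<Rightarrow> (nat \<Rightarrow> nat \<Rightarrow> nat) \<Rightarrow> var mpoly set" where
  "basisG n k c =
     {mvar (VX i j) * mvar (VD i) - mvar (VT i j) * mvar VB ^ c i j | i j.
        1 \<le> i \<and> i \<le> n \<and> 1 \<le> j \<and> j \<le> k i} \<union>
     {mvar (VX i q) * mvar (VT i p) - mvar (VX i p) * mvar (VT i q) * mvar VB ^ (c i q - c i p)
        | i q p. 1 \<le> i \<and> i \<le> n \<and> 1 \<le> q \<and> q < p \<and> p \<le> k i}"

end

theory Submission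
  imports Defs "HOL-Library.Function_Algebras"
begin

text \<open>Group the monomials \<open>z\<^sup>\<alpha>\<close> into fibres according to \<open>A \<alpha>\<close>. Two monomials of one fibre are congruent modulo
the toric ideal, and conversely the coefficients of an element of the ideal add up to zero in each
fibre: the ideal lies in the kernel of the ring homomorphism sending \<open>z\<^sup>\<alpha>\<close> to a formal monomial
with exponent \<open>A \<alpha>\<close>. Hence the leading monomial of a nonzero element of the ideal is never the
smallest monomial of its fibre.

Consequently a finite set of binomials in the ideal is a Groebner basis as soon as every standard
monomial, i.e. every monomial not divisible by one of the leading monomials, is the smallest
monomial of its fibre (\<open>reduced_groebner_basis_of_fibre_minima\<close>).

For the basis in question the leading monomials are \<open>x\<^sub>i\<^sub>j d\<^sub>i\<close> and, for \<open>q < p\<close>, \<open>x\<^sub>i\<^sub>q t\<^sub>i\<^sub>p\<close>. In a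
standard monomial the surplus \<open>d\<^sub>i\<close> vanishes as soon as some \<open>x\<^sub>i\<^sub>j\<close> occurs, so no more is bought
than the fibre demands; and an item \<open>x\<^sub>i\<^sub>q\<close> occurs only if all later items \<open>x\<^sub>i\<^sub>p\<close> of the block are
bought up to their capacity, the slack \<open>t\<^sub>i\<^sub>p\<close> being zero. Such a monomial is the greedy solution which
fills every block from its last, cheapest item. The greedy solution is lexicographically smallest
(\<open>greedy_lex_minimal\<close>) and, by an exchange argument, has the least cost (\<open>greedy_cost_minimal\<close>),
which settles both term orders.\<close>

section \<open>Ideals of a polynomial ring\<close>

text \<open>Closure under additive inverses follows from \<open>mult\<close> with the constant \<open>-1\<close>.\<close>

lemma mpoly_idealI:
  assumes sub: "I \<subseteq> carrier (mpoly_ring V)" and zero: "0 \<in> I"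
    and add: "\<And>p q. p \<in> I \<Longrightarrow> q \<in> I \<Longrightarrow> p + q \<in> I"
    and mult: "\<And>p q. p \<in> I \<Longrightarrow> q \<in> carrier (mpoly_ring V) \<Longrightarrow> q * p \<in> I"
  shows "ideal I (mpoly_ring V)"
proof -
  interpret cring "mpoly_ring V" by (rule cring_mpoly_ring)
  note ops = mpoly_ring_simps(2-5)
  have minus_one: "\<ominus>\<^bsub>mpoly_ring V\<^esub> \<one>\<^bsub>mpoly_ring V\<^esub> \<in> carrier (mpoly_ring V)"
    by simp
  show ?thesis
  proof (rule idealI)
    show "ring (mpoly_ring V)" by (rule ring_axioms)
    show "subgroup I (add_monoid (mpoly_ring V))"
    proof (rule group.subgroupI)
      show "Group.group (add_monoid (mpoly_ring V))" by (rule add.group_axioms)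
      show "I \<subseteq> carrier (add_monoid (mpoly_ring V))" using sub by simp
      show "I \<noteq> {}" using zero by blast
      show "inv\<^bsub>add_monoid (mpoly_ring V)\<^esub> p \<in> I" if p: "p \<in> I" for p
      proof -
        have "inv\<^bsub>add_monoid (mpoly_ring V)\<^esub> p
            = (\<ominus>\<^bsub>mpoly_ring V\<^esub> \<one>\<^bsub>mpoly_ring V\<^esub>) \<otimes>\<^bsub>mpoly_ring V\<^esub> p"
          using p sub l_minus[of "\<one>\<^bsub>mpoly_ring V\<^esub>" p] by (auto simp: a_inv_def)
        then show ?thesis using mult[OF p minus_one] by (simp only: ops)
      qed
      show "p \<otimes>\<^bsub>add_monoid (mpoly_ring V)\<^esub> q \<in> I" if "p \<in> I" "q \<in> I" for p q
        using add[OF that] by (simp add: ops)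
    qed
    show "q \<otimes>\<^bsub>mpoly_ring V\<^esub> p \<in> I" "p \<otimes>\<^bsub>mpoly_ring V\<^esub> q \<in> I"
      if "p \<in> I" "q \<in> carrier (mpoly_ring V)" for p q
      using mult[OF that] by (simp_all add: ops mult.commute)
  qed
qed

lemma single_in_mpoly_ring: "keys m \<subseteq> V \<Longrightarrow> Poly_Mapping.single m a \<in> carrier (mpoly_ring V)"
  by (simp add: mpoly_ring_simps(1))

lemma mmonom_diff_in_mpoly_ring:
  assumes "keys a \<subseteq> V" "keys b \<subseteq> V"
  shows "mmonom a - mmonom b \<in> carrier (mpoly_ring V)"
proof -
  have "keys (mmonom a - mmonom b) \<subseteq> {a, b}"
    by (auto simp: mmonom_def in_keys_iff lookup_minus lookup_single when_def split: if_splits)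
  then show ?thesis using assms by (auto simp: mpoly_ring_simps(1))
qed

definition exp_dvd :: "'v exponent \<Rightarrow> 'v exponent \<Rightarrow> bool" where
  "exp_dvd l m \<longleftrightarrow> (\<forall>v. lookup l v \<le> lookup m v)"

lemma exp_dvd_add: "exp_dvd l m \<Longrightarrow> exp_dvd l (e + m)"
  by (auto simp: exp_dvd_def lookup_add intro: trans_le_add2)

lemma exp_dvd_add_diff: "exp_dvd l m \<Longrightarrow> (m - l) + l = m"
  by (rule poly_mapping_eqI) (simp add: exp_dvd_def lookup_add lookup_minus)

lemma keys_exp_diff: "keys (m - l :: 'v exponent) \<subseteq> keys m"
  by (auto simp: in_keys_iff lookup_minus)

text \<open>The polynomials all of whose monomials are divisible by some member of \<open>L\<close> form an ideal, because
divisibility survives multiplication by any monomial. That ideal contains the generators.\<close>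

lemma exp_dvd_of_in_monomial_ideal:
  assumes L: "\<And>l. l \<in> L \<Longrightarrow> keys l \<subseteq> V"
    and f: "f \<in> Idl\<^bsub>mpoly_ring V\<^esub> (mmonom ` L)" and m: "m \<in> keys f"
  shows "\<exists>l \<in> L. exp_dvd l m"
proof -
  interpret cring "mpoly_ring V" by (rule cring_mpoly_ring)
  let ?I = "{p \<in> carrier (mpoly_ring V). \<forall>m \<in> keys p. \<exists>l \<in> L. exp_dvd l m}"
  have "ideal ?I (mpoly_ring V)"
  proof (rule mpoly_idealI)
    show "?I \<subseteq> carrier (mpoly_ring V)" by blast
    show "0 \<in> ?I" by (simp add: mpoly_ring_simps(1))
    show "p + q \<in> ?I" if "p \<in> ?I" "q \<in> ?I" for p q
      using that keys_add[of p q] a_closed[of p q] by (auto simp: mpoly_ring_simps(4))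
    show "q * p \<in> ?I" if p: "p \<in> ?I" and q: "q \<in> carrier (mpoly_ring V)" for p q
    proof -
      have "q * p \<in> carrier (mpoly_ring V)"
        using p q m_closed[of q p] by (simp add: mpoly_ring_simps(2))
      then show ?thesis
        using p keys_mult[of q p] by (fastforce intro: exp_dvd_add)
    qed
  qed
  moreover have "mmonom ` L \<subseteq> ?I"
    using L by (fastforce simp: mmonom_def mpoly_ring_simps(1) exp_dvd_def)
  ultimately show ?thesis using genideal_minimal[of ?I "mmonom ` L"] f m by blast
qed

section \<open>Fibres of a toric ideal\<close>

text \<open>The linear extension of \<open>z^m \<mapsto> z^(h m)\<close>. Its coefficients are the coefficient sums over the fibres
of \<open>h\<close>; for additive \<open>h\<close> it is the ring homomorphism of monoid algebras induced by \<open>h\<close>.\<close>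

definition pushforward :: "('a \<Rightarrow> 'b) \<Rightarrow> ('a \<Rightarrow>\<^sub>0 real) \<Rightarrow> ('b \<Rightarrow>\<^sub>0 real)" where
  "pushforward h f = (\<Sum>m \<in> keys f. Poly_Mapping.single (h m) (lookup f m))"

lemma pushforward_zero [simp]: "pushforward h 0 = 0"
  by (simp add: pushforward_def)

lemma pushforward_single [simp]:
  "pushforward h (Poly_Mapping.single m a) = Poly_Mapping.single (h m) a"
  by (simp add: pushforward_def)

lemma pushforward_add: "pushforward h (f + g) = pushforward h f + pushforward h g"
  unfolding pushforward_def by (rule setsum_keys_plus_distrib) (simp_all add: single_add)

lemma pushforward_sum: "pushforward h (\<Sum>x \<in> S. f x) = (\<Sum>x \<in> S. pushforward h (f x))"
  by (induction S rule: infinite_finite_induct) (simp_all add: pushforward_add)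

lemma sum_monomials: "f = (\<Sum>m \<in> keys f. Poly_Mapping.single m (lookup f m))"
  by (rule poly_mapping_eqI)
    (auto simp: lookup_sum lookup_single when_def in_keys_iff)

lemma pushforward_mult:
  fixes h :: "'a::comm_monoid_add \<Rightarrow> 'b::comm_monoid_add"
  assumes "\<And>a b. h (a + b) = h a + h b"
  shows "pushforward h (f * g) = pushforward h f * pushforward h g"
proof -
  have "f * g = (\<Sum>m \<in> keys f. \<Sum>m' \<in> keys g.
      Poly_Mapping.single (m + m') (lookup f m * lookup g m'))"
    by (subst sum_monomials[of f], subst sum_monomials[of g])
      (simp add: sum_product mult_single)
  then have "pushforward h (f * g) = (\<Sum>m \<in> keys f. \<Sum>m' \<in> keys g.
      Poly_Mapping.single (h m + h m') (lookup f m * lookup g m'))"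
    by (simp add: pushforward_sum assms)
  also have "\<dots> = pushforward h f * pushforward h g"
    by (simp add: pushforward_def sum_product mult_single)
  finally show ?thesis .
qed

text \<open>The coefficients in the fibre of \<open>m\<close> add up to zero, which a single nonzero coefficient cannot do.\<close>

lemma pushforward_eq_zero_collision:
  assumes f: "pushforward h f = 0" and m: "m \<in> keys f"
  shows "\<exists>m' \<in> keys f. m' \<noteq> m \<and> h m' = h m"
proof (rule ccontr)
  assume "\<not> ?thesis"
  then have "lookup (pushforward h f) (h m) = (\<Sum>m' \<in> keys f. if m' = m then lookup f m' else 0)"
    unfolding pushforward_def lookup_sum lookup_single when_def
    by (intro sum.cong) auto
  with f m show False by (simp add: in_keys_iff)
qed

text \<open>The vector \<open>A \<alpha>\<close>, extended by zero outside \<open>R\<close>, so that agreement on all rows is equality of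
functions and degrees can serve as exponents of a monoid algebra.\<close>

definition mat_degree ::
    "'r set \<Rightarrow> 'v set \<Rightarrow> ('r \<Rightarrow> 'v \<Rightarrow> int) \<Rightarrow> 'v exponent \<Rightarrow> 'r \<Rightarrow> int" where
  "mat_degree R V A \<alpha> = (\<lambda>r. if r \<in> R then \<Sum>v \<in> V. A r v * int (lookup \<alpha> v) else 0)"

lemma mat_degree_add: "mat_degree R V A (\<alpha> + \<beta>) = mat_degree R V A \<alpha> + mat_degree R V A \<beta>"
  by (rule ext) (simp add: mat_degree_def lookup_add algebra_simps sum.distrib)

lemma mat_degree_eq_iff:
  "mat_degree R V A \<alpha> = mat_degree R V A \<beta> \<longleftrightarrow>
    (\<forall>r \<in> R. (\<Sum>v \<in> V. A r v * int (lookup \<alpha> v)) = (\<Sum>v \<in> V. A r v * int (lookup \<beta> v)))"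
  by (auto simp: mat_degree_def fun_eq_iff)

lemma toric_ideal_alt:
  "toric_ideal R V A = Idl\<^bsub>mpoly_ring V\<^esub> {mmonom \<alpha> - mmonom \<beta> | \<alpha> \<beta>.
     keys \<alpha> \<subseteq> V \<and> keys \<beta> \<subseteq> V \<and> mat_degree R V A \<alpha> = mat_degree R V A \<beta>}"
  unfolding toric_ideal_def mat_degree_eq_iff ..

lemma binomial_in_toric_ideal:
  assumes "keys \<alpha> \<subseteq> V" "keys \<beta> \<subseteq> V" "mat_degree R V A \<alpha> = mat_degree R V A \<beta>"
  shows "mmonom \<alpha> - mmonom \<beta> \<in> toric_ideal R V A"
  using assms unfolding toric_ideal_alt genideal_def by blast

text \<open>The right-hand side is the kernel of a ring homomorphism and contains the generating binomials,
whose two monomials have the same image.\<close>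

lemma toric_ideal_subset:
  "toric_ideal R V A \<subseteq> {f \<in> carrier (mpoly_ring V). pushforward (mat_degree R V A) f = 0}"
    (is "_ \<subseteq> ?I")
proof -
  interpret cring "mpoly_ring V" by (rule cring_mpoly_ring)
  have "ideal ?I (mpoly_ring V)"
  proof (rule mpoly_idealI)
    show "?I \<subseteq> carrier (mpoly_ring V)" by blast
    show "0 \<in> ?I" by (simp add: mpoly_ring_simps(1))
    show "p + q \<in> ?I" if "p \<in> ?I" "q \<in> ?I" for p q
      using that a_closed[of p q] by (simp add: mpoly_ring_simps(4) pushforward_add)
    show "q * p \<in> ?I" if "p \<in> ?I" "q \<in> carrier (mpoly_ring V)" for p q
      using that m_closed[of q p]
      by (simp add: mpoly_ring_simps(2) pushforward_mult mat_degree_add)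
  qed
  moreover have "mmonom \<alpha> - mmonom \<beta> \<in> ?I"
    if "keys \<alpha> \<subseteq> V" "keys \<beta> \<subseteq> V" "mat_degree R V A \<alpha> = mat_degree R V A \<beta>" for \<alpha> \<beta>
  proof -
    have "pushforward (mat_degree R V A) (mmonom \<alpha> - mmonom \<beta>) = 0"
      using pushforward_add[of "mat_degree R V A" "mmonom \<alpha> - mmonom \<beta>" "mmonom \<beta>"] that(3)
      by (simp add: mmonom_def)
    then show ?thesis using mmonom_diff_in_mpoly_ring[OF that(1,2)] by simp
  qed
  ultimately show ?thesis
    unfolding toric_ideal_alt by (intro genideal_minimal) auto
qed

section \<open>Binomial Groebner bases from minimal monomials of fibres\<close>

lemma lead_exp_greatest:
  assumes ord: "asymp prec" "transp prec" "totalp prec" and f: "f \<noteq> 0"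
  shows "lead_exp prec f \<in> keys f \<and> (\<forall>m \<in> keys f. m \<noteq> lead_exp prec f \<longrightarrow> prec m (lead_exp prec f))"
proof -
  have "\<exists>m \<in> keys f. \<forall>m' \<in> keys f. m' \<noteq> m \<longrightarrow> prec m' m"
    using f ord by (intro Finite_Set.bex_greatest_element)
      (auto intro: transp_on_subset totalp_on_subset asymp_on_subset)
  then have "\<exists>!m. m \<in> keys f \<and> (\<forall>m' \<in> keys f. m' \<noteq> m \<longrightarrow> prec m' m)"
    using asympD[OF ord(1)] by (metis (no_types))
  from theI'[OF this] show ?thesis unfolding lead_exp_def by blast
qed

lemma keys_binomial: "a \<noteq> b \<Longrightarrow> keys (mmonom a - mmonom b) = {a, b}"
  by (auto simp: mmonom_def in_keys_iff lookup_minus lookup_single when_def split: if_splits)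

lemma lead_binomial:
  assumes "asymp prec" "prec b a"
  shows "lead_exp prec (mmonom a - mmonom b) = a" "lead_coef prec (mmonom a - mmonom b) = 1"
    "lead_term prec (mmonom a - mmonom b) = mmonom a"
proof -
  have ab: "a \<noteq> b" using asympD[OF assms(1)] assms(2) by blast
  show *: "lead_exp prec (mmonom a - mmonom b) = a"
    unfolding lead_exp_def keys_binomial[OF ab]
    using assms asympD[OF assms(1)] by (intro the_equality) auto
  show **: "lead_coef prec (mmonom a - mmonom b) = 1"
    unfolding lead_coef_def * using ab by (simp add: mmonom_def lookup_minus lookup_single when_def)
  show "lead_term prec (mmonom a - mmonom b) = mmonom a"
    unfolding lead_term_def * ** by (simp add: mmonom_def)
qed

lemma single_in_ideal_of_exp_dvd:
  assumes l: "keys l \<subseteq> V" and m: "keys m \<subseteq> V" "exp_dvd l m"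
    and I: "ideal I (mpoly_ring V)" "mmonom l \<in> I"
  shows "Poly_Mapping.single m a \<in> I"
proof -
  have "Poly_Mapping.single (m - l) a * mmonom l = Poly_Mapping.single m a"
    using exp_dvd_add_diff[OF m(2)] by (simp add: mmonom_def mult_single)
  moreover have "Poly_Mapping.single (m - l) a \<in> carrier (mpoly_ring V)"
    using keys_exp_diff[of m l] m(1) by (intro single_in_mpoly_ring) blast
  ultimately show ?thesis
    using ideal.I_l_closed[OF I(1) I(2)] by (metis mpoly_ring_simps(2))
qed

text \<open>A pair \<open>(a, b)\<close> of \<open>B\<close> stands for the binomial with leading exponent \<open>a\<close> and tail \<open>b\<close>. If the leading
monomial of some \<open>f\<close> in the toric ideal were standard, it would by \<open>minimal\<close> be smaller than the
other monomials of its fibre; but \<open>f\<close> contains another one of these, and that one is smaller than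
the leading monomial. So leading monomials are nonstandard, and the initial ideal is generated by
the leading monomials of \<open>B\<close>. Being reduced is then a question of divisibility between exponents.\<close>

lemma reduced_groebner_basis_of_fibre_minima:
  assumes ord: "asymp prec" "transp prec" "totalp prec"
    and fin: "finite B"
    and vars: "\<And>a b. (a, b) \<in> B \<Longrightarrow> keys a \<subseteq> V \<and> keys b \<subseteq> V"
    and deg: "\<And>a b. (a, b) \<in> B \<Longrightarrow> mat_degree R V A a = mat_degree R V A b"
    and lead: "\<And>a b. (a, b) \<in> B \<Longrightarrow> prec b a"
    and minimal: "\<And>m m'. keys m \<subseteq> V \<Longrightarrow> keys m' \<subseteq> V \<Longrightarrow> (\<forall>l \<in> fst ` B. \<not> exp_dvd l m) \<Longrightarrow>
      mat_degree R V A m = mat_degree R V A m' \<Longrightarrow> m \<noteq> m' \<Longrightarrow> prec m m'"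
    and lead_red: "\<And>a b a' b'. (a, b) \<in> B \<Longrightarrow> (a', b') \<in> B \<Longrightarrow> exp_dvd a' a \<Longrightarrow> (a', b') = (a, b)"
    and tail_red: "\<And>a b a' b'. (a, b) \<in> B \<Longrightarrow> (a', b') \<in> B \<Longrightarrow> \<not> exp_dvd a' b"
  shows "reduced_groebner_basis V prec (toric_ideal R V A) ((\<lambda>(a, b). mmonom a - mmonom b) ` B)"
proof -
  interpret cring "mpoly_ring V" by (rule cring_mpoly_ring)
  let ?g = "\<lambda>(a, b). mmonom a - mmonom b"
  let ?G = "?g ` B"
  let ?J = "toric_ideal R V A"
  have lead_B: "lead_term prec ` ?g ` C = mmonom ` fst ` C" if "C \<subseteq> B" for C
    unfolding image_image using that lead_binomial(3)[OF ord(1) lead]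
    by (intro image_cong refl) auto
  have keys_lead_B: "keys l \<subseteq> V" if "l \<in> fst ` B" for l
  proof -
    from that obtain b where "(l, b) \<in> B" by auto
    then show ?thesis using vars by blast
  qed
  have G_J: "?G \<subseteq> ?J"
    using vars deg by (auto intro!: binomial_in_toric_ideal)
  have J: "?J \<subseteq> carrier (mpoly_ring V)"
    using toric_ideal_subset by blast
  have J_keys: "keys m \<subseteq> V" if "f \<in> ?J" "m \<in> keys f" for f m
    using J that mpoly_ring_simps(1)[of f V] by blast
  have nonstd: "\<exists>l \<in> fst ` B. exp_dvd l (lead_exp prec f)" if f: "f \<in> ?J" "f \<noteq> 0" for f
  proof (rule ccontr)
    assume std: "\<not> ?thesis"
    let ?m = "lead_exp prec f"
    have m: "?m \<in> keys f" using lead_exp_greatest[OF ord f(2)] by blast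
    obtain m' where m': "m' \<in> keys f" "m' \<noteq> ?m" "mat_degree R V A m' = mat_degree R V A ?m"
      using pushforward_eq_zero_collision[OF _ m] toric_ideal_subset f(1) by blast
    have "keys ?m \<subseteq> V" "keys m' \<subseteq> V"
      using J_keys[OF f(1)] m m'(1) by blast+
    then have "prec ?m m'" using minimal[of ?m m'] std m' by auto
    moreover have "prec m' ?m" using lead_exp_greatest[OF ord f(2)] m'(1,2) by blast
    ultimately show False using asympD[OF ord(1)] by blast
  qed
  have lt_G: "lead_term prec ` ?G \<subseteq> carrier (mpoly_ring V)"
    unfolding lead_B[OF order_refl] unfolding mmonom_def
    by (rule image_subsetI) (rule single_in_mpoly_ring[OF keys_lead_B])
  have keys_lead: "keys (lead_exp prec f) \<subseteq> V" if "f \<in> ?J" "f \<noteq> 0" for f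
    using lead_exp_greatest[OF ord that(2)] J_keys[OF that(1)] by blast
  have I: "ideal (initial_ideal V prec ?G) (mpoly_ring V)"
    unfolding initial_ideal_def by (rule genideal_ideal[OF lt_G])
  have "lead_term prec f \<in> initial_ideal V prec ?G" if f: "f \<in> ?J" for f
  proof (cases "f = 0")
    case True
    then show ?thesis
      using additive_subgroup.zero_closed[OF ideal.axioms(1)[OF I]] by (simp add: mpoly_ring_simps(5))
  next
    case False
    then obtain l where l: "l \<in> fst ` B" "exp_dvd l (lead_exp prec f)"
      using nonstd f by blast
    have "mmonom l \<in> initial_ideal V prec ?G"
      using genideal_self[OF lt_G] l(1) unfolding initial_ideal_def lead_B[OF order_refl] by blast
    then show ?thesis
      unfolding lead_term_def
      using single_in_ideal_of_exp_dvd[OF keys_lead_B[OF l(1)] keys_lead[OF f False] l(2) I] by blast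
  qed
  then have in_J: "initial_ideal V prec ?J \<subseteq> initial_ideal V prec ?G"
    using genideal_minimal[OF I, of "lead_term prec ` ?J"] unfolding initial_ideal_def by blast
  have "initial_ideal V prec ?G \<subseteq> initial_ideal V prec ?J"
    unfolding initial_ideal_def genideal_def using image_mono[OF G_J, of "lead_term prec"] by blast
  with in_J have "initial_ideal V prec ?J = initial_ideal V prec ?G"
    by blast
  then have "groebner_basis V prec ?J ?G"
    using fin G_J unfolding groebner_basis_def by blast
  moreover have "mmonom m \<notin> initial_ideal V prec (?G - {?g (a, b)})"
    if ab: "(a, b) \<in> B" and m: "m \<in> keys (?g (a, b))" for a b m
  proof
    assume "mmonom m \<in> initial_ideal V prec (?G - {?g (a, b)})"
    moreover define C where "C = {x \<in> B. ?g x \<noteq> ?g (a, b)}"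
    have image_minus: "f ` S - {y} = f ` {x \<in> S. f x \<noteq> y}" for f :: "'x \<Rightarrow> 'y" and S y
      by blast
    have "?G - {?g (a, b)} = ?g ` C" unfolding C_def by (rule image_minus)
    moreover have "C \<subseteq> B" unfolding C_def by blast
    ultimately have "mmonom m \<in> Idl\<^bsub>mpoly_ring V\<^esub> (mmonom ` fst ` C)"
      using lead_B[of C] unfolding initial_ideal_def by simp
    then have "\<exists>l \<in> fst ` C. exp_dvd l m"
    proof (rule exp_dvd_of_in_monomial_ideal[rotated])
      show "m \<in> keys (mmonom m)" by (simp add: mmonom_def)
      show "keys l \<subseteq> V" if "l \<in> fst ` C" for l using that keys_lead_B \<open>C \<subseteq> B\<close> by blast
    qed
    then obtain a' b' where C: "(a', b') \<in> C" "exp_dvd a' m" by auto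
    have "a \<noteq> b" using lead[OF ab] asympD[OF ord(1)] by blast
    with m have "m = a \<or> m = b" by (simp add: keys_binomial)
    then show False
      using lead_red[OF ab, of a' b'] tail_red[OF ab, of a' b'] C unfolding C_def by auto
  qed
  moreover have "lead_coef prec (?g (a, b)) = 1" if "(a, b) \<in> B" for a b
    using lead_binomial(2)[OF ord(1) lead[OF that]] by simp
  ultimately show ?thesis
    unfolding reduced_groebner_basis_def by auto
qed

section \<open>The exponents of the basis\<close>

text \<open>The pairs of leading exponent and tail exponent of the binomials in the basis. With
descending costs the first component is the larger one in both term orders.\<close>

definition basis_exps ::
    "nat \<Rightarrow> (nat \<Rightarrow> nat) \<Rightarrow> (nat \<Rightarrow> nat \<Rightarrow> nat) \<Rightarrow> (var exponent \<times> var exponent) set" where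
  "basis_exps n k c =
     {(Poly_Mapping.single (VX i j) 1 + Poly_Mapping.single (VD i) 1,
       Poly_Mapping.single (VT i j) 1 + Poly_Mapping.single VB (c i j)) | i j.
        1 \<le> i \<and> i \<le> n \<and> 1 \<le> j \<and> j \<le> k i} \<union>
     {(Poly_Mapping.single (VX i q) 1 + Poly_Mapping.single (VT i p) 1,
       Poly_Mapping.single (VX i p) 1 + Poly_Mapping.single (VT i q) 1
         + Poly_Mapping.single VB (c i q - c i p)) | i q p.
        1 \<le> i \<and> i \<le> n \<and> 1 \<le> q \<and> q < p \<and> p \<le> k i}"

lemma basis_exps_cases [consumes 1, case_names d_swap t_swap]:
  assumes "(a, b) \<in> basis_exps n k c"
  obtains i j where "1 \<le> i" "i \<le> n" "1 \<le> j" "j \<le> k i"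
      "a = Poly_Mapping.single (VX i j) 1 + Poly_Mapping.single (VD i) 1"
      "b = Poly_Mapping.single (VT i j) 1 + Poly_Mapping.single VB (c i j)"
    | i q p where "1 \<le> i" "i \<le> n" "1 \<le> q" "q < p" "p \<le> k i"
      "a = Poly_Mapping.single (VX i q) 1 + Poly_Mapping.single (VT i p) 1"
      "b = Poly_Mapping.single (VX i p) 1 + Poly_Mapping.single (VT i q) 1
        + Poly_Mapping.single VB (c i q - c i p)"
  using assms unfolding basis_exps_def by blast

lemma lead_in_basis_exps:
  "\<lbrakk>1 \<le> i; i \<le> n; 1 \<le> j; j \<le> k i\<rbrakk> \<Longrightarrow>
    Poly_Mapping.single (VX i j) 1 + Poly_Mapping.single (VD i) 1 \<in> fst ` basis_exps n k c"
  "\<lbrakk>1 \<le> i; i \<le> n; 1 \<le> q; q < p; p \<le> k i\<rbrakk> \<Longrightarrow>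
    Poly_Mapping.single (VX i q) 1 + Poly_Mapping.single (VT i p) 1 \<in> fst ` basis_exps n k c"
  unfolding basis_exps_def by (rule image_eqI, rule fst_conv[symmetric], blast)+

lemma finite_basis_exps: "finite (basis_exps n k c)"
proof -
  have "finite {f i j | i j. 1 \<le> i \<and> i \<le> n \<and> 1 \<le> j \<and> j \<le> k i}" for f :: "nat \<Rightarrow> nat \<Rightarrow> 'x"
    by (rule finite_subset[of _ "(\<lambda>(i, j). f i j) ` pairs n k"]) (force simp: pairs_def finite_pairs)+
  moreover have "finite {f i q p | i q p. 1 \<le> i \<and> i \<le> n \<and> 1 \<le> q \<and> q < p \<and> p \<le> k i}"
    for f :: "nat \<Rightarrow> nat \<Rightarrow> nat \<Rightarrow> 'x"
    by (rule finite_subset[of _ "(\<lambda>(i, q, p). f i q p) ` (SIGMA i:{1..n}. {1..k i} \<times> {1..k i})"])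
      force+
  ultimately show ?thesis unfolding basis_exps_def by (intro finite_UnI)
qed

lemma mmonom_add: "mmonom (a + b) = mmonom a * mmonom b"
  by (simp add: mmonom_def mult_single)

lemma mmonom_single: "mmonom (Poly_Mapping.single v a) = mvar v ^ a"
proof (induction a)
  case (Suc a)
  then show ?case
    using mmonom_add[of "Poly_Mapping.single v 1" "Poly_Mapping.single v a"]
    by (simp add: single_add[symmetric] mvar_def mmonom_def)
qed (simp add: mmonom_def)

lemma basisG_eq: "basisG n k c = (\<lambda>(a, b). mmonom a - mmonom b) ` basis_exps n k c"
proof -
  have image2: "g ` {f i j | i j. P i j} = {g (f i j) | i j. P i j}"
    for g :: "'x \<Rightarrow> 'y" and f :: "nat \<Rightarrow> nat \<Rightarrow> 'x" and P
    by blast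
  have image3: "g ` {f i q p | i q p. P i q p} = {g (f i q p) | i q p. P i q p}"
    for g :: "'x \<Rightarrow> 'y" and f :: "nat \<Rightarrow> nat \<Rightarrow> nat \<Rightarrow> 'x" and P
    by blast
  show ?thesis
    by (simp only: basisG_def basis_exps_def image_Un image2 image3 prod.case
        mmonom_add mmonom_single power_one_right)
qed

lemma in_vars:
  "VX i j \<in> vars n k \<longleftrightarrow> 1 \<le> i \<and> i \<le> n \<and> 1 \<le> j \<and> j \<le> k i"
  "VD i \<in> vars n k \<longleftrightarrow> 1 \<le> i \<and> i \<le> n"
  "VT i j \<in> vars n k \<longleftrightarrow> 1 \<le> i \<and> i \<le> n \<and> 1 \<le> j \<and> j \<le> k i"
  "VB \<in> vars n k"
  by (auto simp: vars_def pairs_def)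

lemma finite_vars: "finite (vars n k)"
  by (simp add: vars_def finite_pairs)

lemma basis_exps_vars:
  assumes "(a, b) \<in> basis_exps n k c"
  shows "keys a \<subseteq> vars n k \<and> keys b \<subseteq> vars n k"
proof -
  have add: "keys (e + e') \<subseteq> V" if "keys e \<subseteq> V" "keys e' \<subseteq> V" for e e' :: "var exponent" and V
    using that keys_add[of e e'] by blast
  have single: "keys (Poly_Mapping.single v x) \<subseteq> V" if "v \<in> V" for v :: var and x :: nat and V
    using that by simp
  show ?thesis
    using assms
  proof (cases rule: basis_exps_cases)
    case (d_swap i j)
    then show ?thesis by (simp only: in_vars add single simp_thms)
  next
    case (t_swap i q p)
    then have "q \<le> k i" "1 \<le> p" by linarith+
    with t_swap show ?thesis by (simp only: in_vars add single simp_thms)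
  qed
qed

lemma exp_dvd_two_vars:
  assumes "v \<noteq> w"
  shows "exp_dvd (Poly_Mapping.single v 1 + Poly_Mapping.single w 1) m \<longleftrightarrow>
    0 < lookup m v \<and> 0 < lookup m w"
proof -
  have lookup_lead: "lookup (Poly_Mapping.single v 1 + Poly_Mapping.single w 1) u
      = (if u = v \<or> u = w then 1 else (0::nat))" for u
    using assms by (simp add: lookup_add lookup_single when_def)
  show ?thesis unfolding exp_dvd_def lookup_lead by (simp add: Suc_le_eq) blast
qed

lemma basis_exps_lead_reduced:
  assumes "(a, b) \<in> basis_exps n k c" "(a', b') \<in> basis_exps n k c" "exp_dvd a' a"
  shows "(a', b') = (a, b)"
  using assms(1)
proof (cases rule: basis_exps_cases)
  case (d_swap i j)
  note ab = this
  from assms(2) show ?thesis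
  proof (cases rule: basis_exps_cases)
    case (d_swap i' j')
    with ab assms(3) show ?thesis
      by (auto simp: exp_dvd_two_vars[unfolded One_nat_def] lookup_add lookup_single when_def split: if_splits)
  next
    case (t_swap i' q' p')
    with ab assms(3) show ?thesis
      by (auto simp: exp_dvd_two_vars[unfolded One_nat_def] lookup_add lookup_single when_def split: if_splits)
  qed
next
  case (t_swap i q p)
  note ab = this
  from assms(2) show ?thesis
  proof (cases rule: basis_exps_cases)
    case (d_swap i' j')
    with ab assms(3) show ?thesis
      by (auto simp: exp_dvd_two_vars[unfolded One_nat_def] lookup_add lookup_single when_def split: if_splits)
  next
    case (t_swap i' q' p')
    with ab assms(3) show ?thesis
      by (auto simp: exp_dvd_two_vars[unfolded One_nat_def] lookup_add lookup_single when_def split: if_splits)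
  qed
qed

text \<open>The tail of the first kind contains no \<open>x\<close>-variable. A tail of the second kind
consists of \<open>x\<^sub>i\<^sub>p t\<^sub>i\<^sub>q\<close> with \<open>q < p\<close>, where the indices are in the wrong order for a leading
monomial, and a power of \<open>b\<close>.\<close>

lemma basis_exps_tail_reduced:
  assumes "(a, b) \<in> basis_exps n k c" "(a', b') \<in> basis_exps n k c"
  shows "\<not> exp_dvd a' b"
  using assms(1)
proof (cases rule: basis_exps_cases)
  case (d_swap i j)
  note ab = this
  from assms(2) show ?thesis
  proof (cases rule: basis_exps_cases)
    case (d_swap i' j')
    with ab show ?thesis
      by (auto simp: exp_dvd_two_vars[unfolded One_nat_def] lookup_add lookup_single when_def split: if_splits)
  next
    case (t_swap i' q' p')
    with ab show ?thesis
      by (auto simp: exp_dvd_two_vars[unfolded One_nat_def] lookup_add lookup_single when_def split: if_splits)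
  qed
next
  case (t_swap i q p)
  note ab = this
  from assms(2) show ?thesis
  proof (cases rule: basis_exps_cases)
    case (d_swap i' j')
    with ab show ?thesis
      by (auto simp: exp_dvd_two_vars[unfolded One_nat_def] lookup_add lookup_single when_def split: if_splits)
  next
    case (t_swap i' q' p')
    with ab show ?thesis
      by (auto simp: exp_dvd_two_vars[unfolded One_nat_def] lookup_add lookup_single when_def split: if_splits)
  qed
qed

text \<open>The \<open>x\<close>-variable in the leading monomial precedes every other variable of the binomial.\<close>

lemma basis_exps_lex_less:
  assumes "(a, b) \<in> basis_exps n k c"
  shows "lex_less b a"
  using assms
proof (cases rule: basis_exps_cases)
  case (d_swap i j)
  have "lookup b w = lookup a w" if "precedes w (VX i j)" for w
    using that d_swap by (cases w) (auto simp: lookup_add lookup_single when_def)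
  then show ?thesis
    unfolding lex_less_iff using d_swap
    by (intro exI[of _ "VX i j"]) (auto simp: lookup_add lookup_single when_def)
next
  case (t_swap i q p)
  have "lookup b w = lookup a w" if "precedes w (VX i q)" for w
    using that t_swap by (cases w) (auto simp: lookup_add lookup_single when_def)
  then show ?thesis
    unfolding lex_less_iff using t_swap
    by (intro exI[of _ "VX i q"]) (auto simp: lookup_add lookup_single when_def)
qed

section \<open>The rows of the matrix\<close>

abbreviation A_degree ::
    "nat \<Rightarrow> (nat \<Rightarrow> nat) \<Rightarrow> (nat \<Rightarrow> nat \<Rightarrow> nat) \<Rightarrow> var exponent \<Rightarrow> row \<Rightarrow> int" where
  "A_degree n k c \<equiv> mat_degree (rows n k) (vars n k) (matA c)"

lemma mat_degree_single:
  assumes "finite V" "v \<in> V"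
  shows "mat_degree R V A (Poly_Mapping.single v a) r = (if r \<in> R then A r v * int a else 0)"
proof -
  have "(\<Sum>w \<in> V. A r w * int (lookup (Poly_Mapping.single v a) w))
      = (\<Sum>w \<in> V. if w = v then A r w * int a else 0)"
    by (intro sum.cong) (auto simp: lookup_single when_def)
  then show ?thesis using assms by (simp add: mat_degree_def)
qed

lemma basis_exps_degree:
  assumes mono: "\<And>i q p. 1 \<le> i \<Longrightarrow> i \<le> n \<Longrightarrow> 1 \<le> q \<Longrightarrow> q < p \<Longrightarrow> p \<le> k i \<Longrightarrow> c i q \<ge> c i p"
    and ab: "(a, b) \<in> basis_exps n k c"
  shows "A_degree n k c a = A_degree n k c b"
  using ab
proof (cases rule: basis_exps_cases)
  case (d_swap i j)
  then have "A_degree n k c a r = A_degree n k c b r" for r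
    by (cases r) (simp_all add: mat_degree_add mat_degree_single finite_vars in_vars)
  then show ?thesis by blast
next
  case (t_swap i q p)
  then have "A_degree n k c a r = A_degree n k c b r" for r
    using mono[of i q p]
    by (cases r) (simp_all add: mat_degree_add mat_degree_single finite_vars in_vars of_nat_diff)
  then show ?thesis by blast
qed

lemma sum_pairs: "(\<Sum>(i, j) \<in> pairs n k. f i j) = (\<Sum>i = 1..n. \<Sum>j = 1..k i. f i j)"
  unfolding pairs_def by (rule sum.Sigma[symmetric]) auto

lemma sum_vars:
  fixes f :: "var \<Rightarrow> int"
  shows "(\<Sum>v \<in> vars n k. f v) = (\<Sum>i = 1..n. \<Sum>j = 1..k i. f (VX i j)) + (\<Sum>i = 1..n. f (VD i))
    + (\<Sum>i = 1..n. \<Sum>j = 1..k i. f (VT i j)) + f VB"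
proof -
  have X: "sum f ((\<lambda>(i, j). VX i j) ` pairs n k) = (\<Sum>i = 1..n. \<Sum>j = 1..k i. f (VX i j))"
    unfolding sum_pairs[symmetric]
    by (subst sum.reindex) (auto simp: inj_on_def case_prod_unfold)
  have T: "sum f ((\<lambda>(i, j). VT i j) ` pairs n k) = (\<Sum>i = 1..n. \<Sum>j = 1..k i. f (VT i j))"
    unfolding sum_pairs[symmetric]
    by (subst sum.reindex) (auto simp: inj_on_def case_prod_unfold)
  have D: "sum f (VD ` {1..n}) = (\<Sum>i = 1..n. f (VD i))"
    by (subst sum.reindex) (auto simp: inj_on_def)
  have "((\<lambda>(i, j). VX i j) ` pairs n k \<union> VD ` {1..n} \<union> (\<lambda>(i, j). VT i j) ` pairs n k) \<inter> {VB} = {}"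
    "((\<lambda>(i, j). VX i j) ` pairs n k \<union> VD ` {1..n}) \<inter> (\<lambda>(i, j). VT i j) ` pairs n k = {}"
    "(\<lambda>(i, j). VX i j) ` pairs n k \<inter> VD ` {1..n} = {}"
    by auto
  then show ?thesis
    unfolding vars_def by (simp only: sum.union_disjoint finite_pairs finite_imageI finite_UnI
        finite_atLeastAtMost finite.intros X T D) simp
qed

lemma A_degree_Row_D:
  assumes "1 \<le> i" "i \<le> n"
  shows "A_degree n k c m (Row_D i)
    = int (\<Sum>j = 1..k i. lookup m (VX i j)) - int (lookup m (VD i))"
proof -
  have "(\<Sum>i' = 1..n. \<Sum>j = 1..k i'. matA c (Row_D i) (VX i' j) * int (lookup m (VX i' j)))
      = (\<Sum>i' = 1..n. if i' = i then \<Sum>j = 1..k i'. int (lookup m (VX i' j)) else 0)"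
    by (intro sum.cong) auto
  moreover have "(\<Sum>i' = 1..n. matA c (Row_D i) (VD i') * int (lookup m (VD i')))
      = (\<Sum>i' = 1..n. if i' = i then - int (lookup m (VD i')) else 0)"
    by (intro sum.cong) auto
  moreover have "Row_D i \<in> rows n k" using assms by (simp add: rows_def)
  ultimately show ?thesis
    using assms by (simp add: mat_degree_def sum_vars)
qed

lemma A_degree_Row_I:
  assumes "1 \<le> i" "i \<le> n" "1 \<le> j" "j \<le> k i"
  shows "A_degree n k c m (Row_I i j) = int (lookup m (VX i j)) + int (lookup m (VT i j))"
proof -
  have delta: "(\<Sum>i' = 1..n. \<Sum>j' = 1..k i'. matA c (Row_I i j) (C i' j') * f i' j') = f i j"
    if "\<And>i' j'. matA c (Row_I i j) (C i' j') = (if i' = i \<and> j' = j then 1 else 0)" for C f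
  proof -
    have "(\<Sum>i' = 1..n. \<Sum>j' = 1..k i'. matA c (Row_I i j) (C i' j') * f i' j')
        = (\<Sum>i' = 1..n. if i' = i then \<Sum>j' = 1..k i'. if j' = j then f i' j' else 0 else 0)"
      unfolding that by (intro sum.cong) (auto intro!: sum.cong simp del: sum.delta)
    also have "\<dots> = f i j" using assms by simp
    finally show ?thesis .
  qed
  have "Row_I i j \<in> rows n k" using assms by (auto simp: rows_def pairs_def)
  then show ?thesis
    using delta[OF matA.simps(5), of "\<lambda>i' j'. int (lookup m (VX i' j'))"]
      delta[OF matA.simps(7), of "\<lambda>i' j'. int (lookup m (VT i' j'))"]
    by (simp add: mat_degree_def sum_vars)
qed

lemma A_degree_Row_c: "A_degree n k c m Row_c = int (cost n k c m) + int (lookup m VB)"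
  by (simp add: mat_degree_def sum_vars rows_def cost_def sum_pairs)

section \<open>Standard monomials are cheapest in their fibre\<close>

text \<open>These two lemmas concern one block of \<open>K\<close> items: \<open>x\<close>, \<open>t\<close>, \<open>d\<close> are the exponents of a standard
monomial and \<open>x'\<close>, \<open>t'\<close>, \<open>d'\<close> those of any monomial in its fibre.

If \<open>x\<close> were larger than \<open>x'\<close> at the first place \<open>j\<close> where they differ, then \<open>x j > 0\<close>, so \<open>x\<close> is filled
to capacity after \<open>j\<close> and hence \<open>x' \<le> x\<close> everywhere. Then \<open>x'\<close> has the smaller sum, although \<open>x\<close>
has no surplus over the demand.\<close>

lemma greedy_lex_minimal:
  fixes x t x' t' :: "nat \<Rightarrow> nat"
  assumes surplus: "\<And>j. j \<in> {1..K} \<Longrightarrow> 0 < x j \<Longrightarrow> d = 0"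
    and filled: "\<And>q p. 1 \<le> q \<Longrightarrow> q < p \<Longrightarrow> p \<le> K \<Longrightarrow> 0 < x q \<Longrightarrow> t p = 0"
    and capacity: "\<And>j. j \<in> {1..K} \<Longrightarrow> x j + t j = x' j + t' j"
    and demand: "(\<Sum>j = 1..K. x j) + d' = (\<Sum>j = 1..K. x' j) + d"
    and j: "j \<in> {1..K}" and prefix: "\<And>l. 1 \<le> l \<Longrightarrow> l < j \<Longrightarrow> x l = x' l"
  shows "x j \<le> x' j"
proof (rule ccontr)
  assume less: "\<not> x j \<le> x' j"
  have "x' p \<le> x p" if p: "p \<in> {1..K}" for p
  proof (cases p j rule: linorder_cases)
    case less
    then show ?thesis using prefix[of p] p by simp
  next
    case equal
    then show ?thesis using \<open>\<not> x j \<le> x' j\<close> by simp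
  next
    case greater
    then have "t p = 0" using filled[of j p] j p less by simp
    then show ?thesis using capacity[OF p] by simp
  qed
  then have "(\<Sum>p = 1..K. x' p) < (\<Sum>p = 1..K. x p)"
    using j less by (intro sum_strict_mono_ex1) (auto intro!: bexI[of _ j])
  moreover have "d = 0" using surplus[OF j] less by simp
  ultimately show False using demand by simp
qed

text \<open>Let \<open>q\<close> be the first item used by \<open>x\<close>. Items before \<open>q\<close> cost at least \<open>c q\<close> and \<open>x\<close> has none of them;
items after \<open>q\<close> cost at most \<open>c q\<close> and \<open>x\<close> has as many of them as possible. So each product
\<open>(c p - c q) (x' p - x p)\<close> is nonnegative, and the cost difference is at least \<open>c q\<close> times the
difference of the sums, which is nonnegative because \<open>x\<close> has no surplus.\<close>

lemma greedy_cost_minimal: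
  fixes x t x' t' c :: "nat \<Rightarrow> nat"
  assumes surplus: "\<And>j. j \<in> {1..K} \<Longrightarrow> 0 < x j \<Longrightarrow> d = 0"
    and filled: "\<And>q p. 1 \<le> q \<Longrightarrow> q < p \<Longrightarrow> p \<le> K \<Longrightarrow> 0 < x q \<Longrightarrow> t p = 0"
    and capacity: "\<And>j. j \<in> {1..K} \<Longrightarrow> x j + t j = x' j + t' j"
    and demand: "(\<Sum>j = 1..K. x j) + d' = (\<Sum>j = 1..K. x' j) + d"
    and mono: "\<And>q p. 1 \<le> q \<Longrightarrow> q < p \<Longrightarrow> p \<le> K \<Longrightarrow> c p \<le> c q"
  shows "(\<Sum>j = 1..K. c j * x j) \<le> (\<Sum>j = 1..K. c j * x' j)"
proof (cases "\<exists>q. q \<in> {1..K} \<and> 0 < x q")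
  case False
  then have "(\<Sum>j = 1..K. c j * x j) = 0" by (intro sum.neutral) auto
  then show ?thesis by linarith
next
  case True
  define q where "q = (LEAST q. q \<in> {1..K} \<and> 0 < x q)"
  have q: "q \<in> {1..K}" "0 < x q"
    using LeastI_ex[OF True] unfolding q_def by auto
  have below: "x p = 0" if "1 \<le> p" "p < q" for p
    using not_less_Least[of p "\<lambda>q. q \<in> {1..K} \<and> 0 < x q"] that q(1) unfolding q_def by auto
  have "0 \<le> (int (c p) - int (c q)) * (int (x' p) - int (x p))" if p: "p \<in> {1..K}" for p
  proof (cases p q rule: linorder_cases)
    case less
    then show ?thesis using below[of p] mono[of p q] p q(1) by simp
  next
    case equal
    then show ?thesis by simp
  next
    case greater
    then have "t p = 0" using filled[of q p] q p by simp
    then show ?thesis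
      using greater capacity[OF p] mono[of q p] p q(1) by (intro mult_nonpos_nonpos) auto
  qed
  then have "0 \<le> (\<Sum>p = 1..K. (int (c p) - int (c q)) * (int (x' p) - int (x p)))"
    by (rule sum_nonneg)
  also have "\<dots> = (\<Sum>p = 1..K. int (c p) * int (x' p)) - (\<Sum>p = 1..K. int (c p) * int (x p))
      - int (c q) * ((\<Sum>p = 1..K. int (x' p)) - (\<Sum>p = 1..K. int (x p)))"
    by (simp add: algebra_simps sum.distrib sum_subtractf sum_distrib_left)
  finally have "int (c q) * ((\<Sum>p = 1..K. int (x' p)) - (\<Sum>p = 1..K. int (x p)))
      \<le> (\<Sum>p = 1..K. int (c p) * int (x' p)) - (\<Sum>p = 1..K. int (c p) * int (x p))"
    by simp
  moreover have "(\<Sum>p = 1..K. x p) \<le> (\<Sum>p = 1..K. x' p)"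
    using surplus[OF q] demand by simp
  then have "0 \<le> int (c q) * ((\<Sum>p = 1..K. int (x' p)) - (\<Sum>p = 1..K. int (x p)))"
    by (simp flip: of_nat_sum)
  ultimately have "(\<Sum>p = 1..K. int (c p) * int (x p)) \<le> (\<Sum>p = 1..K. int (c p) * int (x' p))"
    by linarith
  then show ?thesis by (simp flip: of_nat_mult of_nat_sum)
qed

lemma fibre_equations:
  assumes "A_degree n k c m = A_degree n k c m'"
  shows "\<lbrakk>1 \<le> i; i \<le> n\<rbrakk> \<Longrightarrow> (\<Sum>j = 1..k i. lookup m (VX i j)) + lookup m' (VD i)
      = (\<Sum>j = 1..k i. lookup m' (VX i j)) + lookup m (VD i)"
    and "\<lbrakk>1 \<le> i; i \<le> n; 1 \<le> j; j \<le> k i\<rbrakk> \<Longrightarrow> lookup m (VX i j) + lookup m (VT i j)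
      = lookup m' (VX i j) + lookup m' (VT i j)"
    and "cost n k c m + lookup m VB = cost n k c m' + lookup m' VB"
proof -
  show "(\<Sum>j = 1..k i. lookup m (VX i j)) + lookup m' (VD i)
      = (\<Sum>j = 1..k i. lookup m' (VX i j)) + lookup m (VD i)" if "1 \<le> i" "i \<le> n"
    using A_degree_Row_D[of i n k c m] A_degree_Row_D[of i n k c m'] that
    unfolding assms by linarith
  show "lookup m (VX i j) + lookup m (VT i j) = lookup m' (VX i j) + lookup m' (VT i j)"
    if "1 \<le> i" "i \<le> n" "1 \<le> j" "j \<le> k i"
    using A_degree_Row_I[of i n j k c m] A_degree_Row_I[of i n j k c m'] that
    unfolding assms by linarith
  show "cost n k c m + lookup m VB = cost n k c m' + lookup m' VB"
    using A_degree_Row_c[of n k c m] A_degree_Row_c[of n k c m'] unfolding assms by linarith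
qed

lemma standard_monomial:
  assumes std: "\<forall>l \<in> fst ` basis_exps n k c. \<not> exp_dvd l m" and i: "1 \<le> i" "i \<le> n"
  shows "\<lbrakk>j \<in> {1..k i}; 0 < lookup m (VX i j)\<rbrakk> \<Longrightarrow> lookup m (VD i) = 0"
    and "\<lbrakk>1 \<le> q; q < p; p \<le> k i; 0 < lookup m (VX i q)\<rbrakk> \<Longrightarrow> lookup m (VT i p) = 0"
proof -
  show "lookup m (VD i) = 0" if "j \<in> {1..k i}" "0 < lookup m (VX i j)"
    using bspec[OF std lead_in_basis_exps(1)[OF i, of j]] exp_dvd_two_vars[of "VX i j" "VD i" m] that
    by simp
  show "lookup m (VT i p) = 0" if "1 \<le> q" "q < p" "p \<le> k i" "0 < lookup m (VX i q)"
    using bspec[OF std lead_in_basis_exps(2)[OF i, of q p]] exp_dvd_two_vars[of "VX i q" "VT i p" m] that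
    by simp
qed

text \<open>The first variable in which two monomials of a fibre differ is an \<open>x\<close>-variable: the rows of the
matrix determine the exponents of \<open>d\<close>, \<open>t\<close> and \<open>b\<close> from those of \<open>x\<close>. There the block argument
applies.\<close>

lemma standard_lex_minimal:
  assumes vars: "keys m \<subseteq> vars n k" "keys m' \<subseteq> vars n k"
    and std: "\<forall>l \<in> fst ` basis_exps n k c. \<not> exp_dvd l m"
    and deg: "A_degree n k c m = A_degree n k c m'" and neq: "m \<noteq> m'"
  shows "lex_less m m'"
proof (rule ccontr)
  note fibre = fibre_equations[OF deg]
  assume "\<not> lex_less m m'"
  then obtain v where v: "lookup m' v < lookup m v"
    and prefix: "\<And>w. precedes w v \<Longrightarrow> lookup m' w = lookup m w"
    using neq lex_less_iff[of m' m] by (metis linorder_neqE)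
  have "v \<in> keys m" using v by (simp add: in_keys_iff)
  then have "v \<in> vars n k" using vars(1) by blast
  then show False
  proof (cases v)
    case (VX i j)
    then have ij: "1 \<le> i" "i \<le> n" "j \<in> {1..k i}"
      using \<open>v \<in> vars n k\<close> by (auto simp: in_vars)
    have "lookup m (VX i j) \<le> lookup m' (VX i j)"
      using ij prefix VX
      by (intro greedy_lex_minimal[OF standard_monomial[OF std ij(1,2)] _ fibre(1)[OF ij(1,2)] ij(3),
            where t' = "\<lambda>j. lookup m' (VT i j)"])
        (auto intro!: fibre(2))
    then show False using v VX by simp
  next
    case (VD i)
    then have "1 \<le> i" "i \<le> n" using \<open>v \<in> vars n k\<close> by (auto simp: in_vars)
    then show False using fibre(1)[of i] prefix v VD by simp
  next
    case (VT i j)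
    then have "1 \<le> i" "i \<le> n" "1 \<le> j" "j \<le> k i"
      using \<open>v \<in> vars n k\<close> by (auto simp: in_vars)
    then show False using fibre(2)[of i j] prefix v VT by simp
  next
    case VB
    then have "cost n k c m = cost n k c m'" using prefix by (simp add: cost_def)
    then show False using fibre(3) v VB by simp
  qed
qed

lemma standard_cost_minimal:
  assumes mono: "\<And>i q p. 1 \<le> i \<Longrightarrow> i \<le> n \<Longrightarrow> 1 \<le> q \<Longrightarrow> q < p \<Longrightarrow> p \<le> k i \<Longrightarrow> c i q \<ge> c i p"
    and std: "\<forall>l \<in> fst ` basis_exps n k c. \<not> exp_dvd l m"
    and deg: "A_degree n k c m = A_degree n k c m'"
  shows "cost n k c m \<le> cost n k c m'"
  unfolding cost_def sum_pairs
proof (rule sum_mono)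
  note fibre = fibre_equations[OF deg]
  fix i assume "i \<in> {1..n}"
  then have i: "1 \<le> i" "i \<le> n" by auto
  show "(\<Sum>j = 1..k i. c i j * lookup m (VX i j)) \<le> (\<Sum>j = 1..k i. c i j * lookup m' (VX i j))"
    using i mono
    by (intro greedy_cost_minimal[OF standard_monomial[OF std i] _ fibre(1)[OF i],
          where t' = "\<lambda>j. lookup m' (VT i j)"])
      (auto intro!: fibre(2))
qed

lemma cost_less_order: "asymp (cost_less n k c)" "transp (cost_less n k c)" "totalp (cost_less n k c)"
  by (auto intro!: asympI transpI totalpI simp: cost_less_def)

theorem theorem1:
  fixes n :: nat and k :: "nat \<Rightarrow> nat" and c :: "nat \<Rightarrow> nat \<Rightarrow> nat"
  assumes "n \<ge> 1"
    and "\<And>i. 1 \<le> i \<Longrightarrow> i \<le> n \<Longrightarrow> k i \<ge> 1"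
    and "\<And>i q p. 1 \<le> i \<Longrightarrow> i \<le> n \<Longrightarrow> 1 \<le> q \<Longrightarrow> q < p \<Longrightarrow> p \<le> k i \<Longrightarrow> c i q \<ge> c i p"
  shows "reduced_groebner_basis (vars n k) lex_less
           (toric_ideal (rows n k) (vars n k) (matA c)) (basisG n k c)
       \<and> reduced_groebner_basis (vars n k) (cost_less n k c)
           (toric_ideal (rows n k) (vars n k) (matA c)) (basisG n k c)"
proof
  have deg: "A_degree n k c a = A_degree n k c b" if "(a, b) \<in> basis_exps n k c" for a b
    using basis_exps_degree[OF assms(3) that] .
  show "reduced_groebner_basis (vars n k) lex_less
      (toric_ideal (rows n k) (vars n k) (matA c)) (basisG n k c)"
    unfolding basisG_eq
    by (rule reduced_groebner_basis_of_fibre_minima)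
      (fact asymp_on_less transp_on_less totalp_on_less finite_basis_exps basis_exps_vars deg
        basis_exps_lex_less standard_lex_minimal basis_exps_lead_reduced basis_exps_tail_reduced)+
  \<comment> \<open>The last row fixes the sum of the cost and the exponent of \<open>b\<close> in a fibre. As leading monomials
    do not contain \<open>b\<close>, they cost at least as much as their tails.\<close>
  have lead: "cost_less n k c b a" if ab: "(a, b) \<in> basis_exps n k c" for a b
  proof -
    have "lookup a VB = 0"
      using ab by (cases rule: basis_exps_cases) (auto simp: lookup_add lookup_single)
    then show ?thesis
      using fibre_equations(3)[OF deg[OF ab]] basis_exps_lex_less[OF ab]
      unfolding cost_less_def by linarith
  qed
  have minimal: "cost_less n k c m m'"
    if "keys m \<subseteq> vars n k" "keys m' \<subseteq> vars n k" "\<forall>l \<in> fst ` basis_exps n k c. \<not> exp_dvd l m"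
      "A_degree n k c m = A_degree n k c m'" "m \<noteq> m'" for m m'
    using standard_cost_minimal[OF assms(3) that(3,4)] standard_lex_minimal[OF that]
    unfolding cost_less_def by linarith
  show "reduced_groebner_basis (vars n k) (cost_less n k c)
      (toric_ideal (rows n k) (vars n k) (matA c)) (basisG n k c)"
    unfolding basisG_eq
    by (rule reduced_groebner_basis_of_fibre_minima)
      (fact cost_less_order finite_basis_exps basis_exps_vars deg lead minimal
        basis_exps_lead_reduced basis_exps_tail_reduced)+
qed

end
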